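(* Let $A$ be a coherent quantale. Then the following are equivalent: (1) $A$ is hyperarchimedean; (2) for all distinct $p,q\in Spec(A)$ there exist $c,d\in K(A)$ such that $c\not\leq p$, $d\not\leq q$ and $cd=0$; (3) $Spec_Z(A)$ is Hausdorff; (4) $Spec_Z(A)$ is a Boolean space; (5) $\mathcal{Z}=\mathcal{P}$; (6) $Spec_F(A)$ is Hausdorff; (7) $Spec_F(A)$ is a Boolean space; (8) $\mathcal{Z}=\mathcal{F}$.
   Context: A quantale here means a complete lattice $A$ with bottom $0$ and top $1$, with an associative commutative multiplication that distributes over arbitrary joins and has $1$ as unit (integral, commutative). $K(A)$ is the set of compact elements of $A$. $A$ is coherent if every element is a join of compact elements, $1\in K(A)$, and $K(A)$ is closed under multiplication. An element $p<1$ is $m$-prime if for all $a,b\in A$, $ab\leq p$ implies $a\leq p$ or $b\leq p$; $Spec(A)$ is the set of $m$-prime elements. $B(A)$ is the Boolean algebra of complemented elements of $A$ (those $e$ for which there is $f$ with $e\vee f=1$, $e\wedge f=0$). $A$ is hyperarchimedean if for every $c\in K(A)$ there is an integer $n>1$ with $c^n\in B(A)$. For $a\in A$ put $V(a)=\{p\in Spec(A): a\leq p\}$, $D(a)=\{p\in Spec(A): a\not\leq p\}$. $Spec_Z(A)$ is $Spec(A)$ with the topology $\mathcal{Z}$ whose closed sets are the $V(a)$, $a\in A$. $Spec_F(A)$ is $Spec(A)$ with the flat topology $\mathcal{F}$, having $\{V(c): c\in K(A)\}$ as a basis of open sets. $\mathcal{P}$ is the patch topology on $Spec(A)$, having $\{D(c)\cap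 V(d): c,d\in K(A)\}$ as a basis of open sets. ($\mathcal{Z},\mathcal{F},\mathcal{P}$ denote the families of open sets.) A Boolean space is a compact Hausdorff space with a basis of clopen sets. *)

theory Defs
  imports "HOL-Analysis.Analysis"
begin

section \<open>Quantales\<close>

text \<open>
  The bottom element \<open>0\<close> of a quantale is written \<^term>\<open>bot\<close>; the top element is both
  \<^term>\<open>top\<close> and the multiplicative unit \<^term>\<open>1\<close>. The one-element quantale is allowed.
\<close>

class quantale = complete_lattice + comm_monoid_mult +
  assumes one_eq_top: "1 = top"
    and times_Sup_distrib: "a * Sup S = Sup ((\<lambda>s. a * s) ` S)"

definition (in complete_lattice) compact_elements :: "'a set" where
  "compact_elements = {c. \<forall>S. c \<le> Sup S \<longrightarrow> (\<exists>F. finite F \<and> F \<subseteq> S \<and> c \<le> Sup F)}"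

class coherent_quantale = quantale +
  assumes Sup_compact: "\<exists>S \<subseteq> compact_elements. a = Sup S"
    and one_compact: "1 \<in> compact_elements"
    and times_compact:
      "c \<in> compact_elements \<Longrightarrow> d \<in> compact_elements \<Longrightarrow> c * d \<in> compact_elements"

definition (in bounded_lattice) complemented_elements :: "'a set" where
  "complemented_elements = {e. \<exists>f. sup e f = top \<and> inf e f = bot}"

definition hyperarchimedean :: "'a::quantale itself \<Rightarrow> bool" where
  "hyperarchimedean (_ :: 'a itself) \<longleftrightarrow>
     (\<forall>c \<in> (compact_elements :: 'a set). \<exists>n::nat. n > 1 \<and> c ^ n \<in> complemented_elements)"


section \<open>The spectrum and its topologies\<close>

definition Spec :: "'a::quantale set" where
  "Spec = {p. p < 1 \<and> (\<forall>a b. a * b \<le> p \<longrightarrow> a \<le> p \<or> b \<le> p)}"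

definition spec_V :: "'a::quantale \<Rightarrow> 'a set" where
  "spec_V a = {p \<in> Spec. a \<le> p}"

definition spec_D :: "'a::quantale \<Rightarrow> 'a set" where
  "spec_D a = {p \<in> Spec. \<not> a \<le> p}"

text \<open>
  The function \<^term>\<open>topology\<close> is meaningful only on families that satisfy \<^term>\<open>istopology\<close>;
  the lemmas below show that the three families do, the one for the patch topology under coherence.
\<close>

definition spec_zariski :: "'a::quantale topology" where
  "spec_zariski = topology (\<lambda>U. \<exists>a. U = Spec - spec_V a)"

definition spec_flat :: "'a::quantale topology" where
  "spec_flat = topology (arbitrary union_of (\<lambda>U. \<exists>c \<in> compact_elements. U = spec_V c))"

definition spec_patch :: "'a::quantale topology" where
  "spec_patch = topology (arbitrary union_of
     (\<lambda>U. \<exists>c \<in> compact_elements. \<exists>d \<in> compact_elements. U = spec_D c \<inter> spec_V d))"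

definition Boolean_space :: "'a topology \<Rightarrow> bool" where
  "Boolean_space X \<longleftrightarrow> compact_space X \<and> Hausdorff_space X \<and>
     (\<exists>\<B>. (\<forall>B \<in> \<B>. openin X B \<and> closedin X B) \<and> openin X = arbitrary union_of (\<lambda>U. U \<in> \<B>))"

lemma spec_V_subset: "spec_V a \<subseteq> Spec" and spec_D_subset: "spec_D a \<subseteq> Spec"
  by (auto simp: spec_V_def spec_D_def)

lemma spec_D_eq: "spec_D a = Spec - spec_V a"
  by (auto simp: spec_V_def spec_D_def)

lemma times_bot: "(a::'a::quantale) * bot = bot"
  using times_Sup_distrib[of a "{}"] by simp

lemma times_mono_right: "(b::'a::quantale) \<le> c \<Longrightarrow> a * b \<le> a * c"
  using times_Sup_distrib[of a "{b, c}"] by (simp add: sup.absorb_iff2 le_iff_sup)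

lemma times_le_left: "(a::'a::quantale) * b \<le> a"
proof -
  have "b \<le> 1" by (simp add: one_eq_top)
  from times_mono_right[OF this, of a] show ?thesis by simp
qed

lemma times_le_right: "(a::'a::quantale) * b \<le> b"
  using times_le_left[of b a] by (simp add: mult.commute)

lemma spec_V_bot: "spec_V bot = Spec"
  by (auto simp: spec_V_def)

lemma spec_V_one: "spec_V (1::'a::quantale) = {}"
  by (auto simp: spec_V_def Spec_def)

lemma spec_V_sup: "spec_V (sup a b) = spec_V a \<inter> spec_V b"
  by (auto simp: spec_V_def)

lemma spec_V_Sup: "spec_V (Sup S) = Spec \<inter> (\<Inter>a\<in>S. spec_V a)"
  by (auto simp: spec_V_def Sup_le_iff)

lemma spec_V_times: "spec_V (a * b) = spec_V a \<union> spec_V b"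
  by (auto simp: spec_V_def Spec_def intro: order_trans[OF times_le_left] order_trans[OF times_le_right])

lemma spec_D_times: "spec_D (a * b) = spec_D a \<inter> spec_D b"
  by (auto simp: spec_D_eq spec_V_times)

lemma compact_bot: "bot \<in> (compact_elements :: 'a::complete_lattice set)"
  by (auto simp: compact_elements_def)

lemma compact_sup:
  fixes c d :: "'a::complete_lattice"
  assumes "c \<in> compact_elements" "d \<in> compact_elements"
  shows "sup c d \<in> compact_elements"
  unfolding compact_elements_def
proof (intro CollectI allI impI)
  fix S :: "'a set" assume "sup c d \<le> Sup S"
  then obtain F G where F: "finite F" "F \<subseteq> S" "c \<le> Sup F" and G: "finite G" "G \<subseteq> S" "d \<le> Sup G"
    using assms unfolding compact_elements_def by (smt (verit) le_sup_iff mem_Collect_eq)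
  have "sup c d \<le> Sup (F \<union> G)"
    using F(3) G(3) by (simp add: Sup_union_distrib le_supI1 le_supI2)
  then show "\<exists>F. finite F \<and> F \<subseteq> S \<and> sup c d \<le> Sup F"
    using F G by (intro exI[of _ "F \<union> G"]) auto
qed

lemma istopology_zariski: "istopology (\<lambda>U. \<exists>a::'a::quantale. U = Spec - spec_V a)"
  unfolding istopology_def
proof (intro conjI allI impI)
  fix U W :: "'a set"
  assume "\<exists>a. U = Spec - spec_V a" "\<exists>a. W = Spec - spec_V a"
  then obtain a b where "U = Spec - spec_V a" "W = Spec - spec_V b" by blast
  then have "U \<inter> W = Spec - spec_V (a * b)" by (auto simp: spec_V_times)
  then show "\<exists>a. U \<inter> W = Spec - spec_V a" by blast
next
  fix \<U> :: "'a set set"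
  assume "\<forall>U\<in>\<U>. \<exists>a. U = Spec - spec_V a"
  then obtain f where f: "\<And>U. U \<in> \<U> \<Longrightarrow> U = Spec - spec_V (f U)" by metis
  have "\<Union>\<U> = (\<Union>U\<in>\<U>. Spec - spec_V (f U))" using f by auto
  also have "\<dots> = Spec - spec_V (Sup (f ` \<U>))" unfolding spec_V_Sup by auto
  finally show "\<exists>a. \<Union>\<U> = Spec - spec_V a" by blast
qed

lemma openin_spec_zariski: "openin spec_zariski U \<longleftrightarrow> (\<exists>a. U = Spec - spec_V a)"
  by (simp add: spec_zariski_def topology_inverse'[OF istopology_zariski])

lemma topspace_spec_zariski: "topspace spec_zariski = Spec"
proof
  show "topspace spec_zariski \<subseteq> Spec" by (auto simp: topspace_def openin_spec_zariski)
  have "openin spec_zariski Spec"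
    using spec_V_one unfolding openin_spec_zariski by (intro exI[of _ 1]) auto
  then show "Spec \<subseteq> topspace spec_zariski" by (rule openin_subset)
qed

lemma closedin_spec_zariski: "closedin spec_zariski C \<longleftrightarrow> (\<exists>a. C = spec_V a)"
proof
  assume "closedin spec_zariski C"
  then obtain a where "C \<subseteq> Spec" "Spec - C = Spec - spec_V a"
    by (auto simp: closedin_def openin_spec_zariski topspace_spec_zariski)
  with spec_V_subset[of a] have "C = spec_V a" by blast
  then show "\<exists>a. C = spec_V a" by blast
next
  assume "\<exists>a. C = spec_V a"
  then show "closedin spec_zariski C"
    using spec_V_subset by (auto simp: closedin_def openin_spec_zariski topspace_spec_zariski)
qed

lemma istopology_flat:
  "istopology (arbitrary union_of (\<lambda>U. \<exists>c::'a::quantale \<in> compact_elements. U = spec_V c))"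
proof (rule istopology_base)
  fix S T :: "'a set"
  assume "\<exists>c\<in>compact_elements. S = spec_V c" "\<exists>c\<in>compact_elements. T = spec_V c"
  then show "\<exists>c\<in>compact_elements. S \<inter> T = spec_V c"
    using compact_sup spec_V_sup by metis
qed

lemma openin_spec_flat:
  "openin spec_flat = arbitrary union_of (\<lambda>U. \<exists>c \<in> compact_elements. U = spec_V c)"
  by (simp add: spec_flat_def topology_inverse'[OF istopology_flat])

lemma topspace_spec_flat: "topspace spec_flat = Spec"
proof
  show "topspace spec_flat \<subseteq> Spec"
    using spec_V_subset unfolding topspace_def openin_spec_flat union_of_def by blast
  have "openin spec_flat Spec"
    unfolding openin_spec_flat using compact_bot spec_V_bot
    by (intro union_of_inc) (auto simp: arbitrary_def)
  then show "Spec \<subseteq> topspace spec_flat" by (rule openin_subset)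
qed

lemma istopology_patch:
  "istopology (arbitrary union_of
     (\<lambda>U. \<exists>c::'a::coherent_quantale \<in> compact_elements. \<exists>d \<in> compact_elements. U = spec_D c \<inter> spec_V d))"
proof (rule istopology_base)
  fix S T :: "'a set"
  assume "\<exists>c\<in>compact_elements. \<exists>d\<in>compact_elements. S = spec_D c \<inter> spec_V d"
    "\<exists>c\<in>compact_elements. \<exists>d\<in>compact_elements. T = spec_D c \<inter> spec_V d"
  then obtain c d c' d' where *: "c \<in> compact_elements" "d \<in> compact_elements"
    "c' \<in> compact_elements" "d' \<in> compact_elements"
    and "S = spec_D c \<inter> spec_V d" "T = spec_D c' \<inter> spec_V d'" by blast
  then have "S \<inter> T = spec_D (c * c') \<inter> spec_V (sup d d')"
    by (auto simp: spec_D_times spec_V_sup)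
  then show "\<exists>c\<in>compact_elements. \<exists>d\<in>compact_elements. S \<inter> T = spec_D c \<inter> spec_V d"
    using * times_compact compact_sup by blast
qed

lemma openin_spec_patch:
  "openin (spec_patch :: 'a::coherent_quantale topology) = arbitrary union_of
     (\<lambda>U. \<exists>c \<in> compact_elements. \<exists>d \<in> compact_elements. U = spec_D c \<inter> spec_V d)"
  by (simp add: spec_patch_def topology_inverse'[OF istopology_patch])

lemma topspace_spec_patch: "topspace (spec_patch :: 'a::coherent_quantale topology) = Spec"
proof
  show "topspace spec_patch \<subseteq> (Spec :: 'a set)"
    using spec_V_subset unfolding topspace_def openin_spec_patch union_of_def by blast
  have "(Spec :: 'a set) = spec_D 1 \<inter> spec_V bot"
    by (simp add: spec_D_eq spec_V_bot spec_V_one)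
  then have "openin spec_patch (Spec :: 'a set)"
    unfolding openin_spec_patch using compact_bot one_compact
    by (intro union_of_inc) (auto simp: arbitrary_def)
  then show "(Spec :: 'a set) \<subseteq> topspace spec_patch" by (rule openin_subset)
qed

end

(* All eight conditions are equivalent to Spec being an antichain, i.e. to every m-prime element being
   maximal. Each of the conditions (2), (3), (5), (6), (8) excludes p < q in Spec directly. Conversely,
   if c is compact and no product c^n * s with s compact and sup c s = 1 vanishes, then these products form
   a multiplicative system; an m-prime p avoiding it satisfies sup c p < 1, so p lies strictly below an
   m-prime q \<ge> sup c p. Hence in an antichain some c^n * s vanishes, and s complements c^n. In turn, when
   A is hyperarchimedean, V(c) = V(c^n) = D(s) for every compact c, so that the three topologies
   coincide and have a basis of clopen sets. *)

theory Submission
  imports Defs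
begin

section \<open>Arithmetic of quantales\<close>

lemma times_sup_distrib: "(a::'a::quantale) * sup b c = sup (a * b) (a * c)"
  using times_Sup_distrib[of a "{b, c}"] by simp

lemma sup_times_distrib: "sup b c * (a::'a::quantale) = sup (b * a) (c * a)"
  by (simp add: mult.commute[of _ a] times_sup_distrib)

lemma times_mono: "(a::'a::quantale) \<le> b \<Longrightarrow> c \<le> d \<Longrightarrow> a * c \<le> b * d"
  by (metis times_mono_right mult.commute order_trans)

lemma times_le_inf: "(a::'a::quantale) * b \<le> inf a b"
  by (simp add: times_le_left times_le_right)

text \<open>When the product is expanded, every term other than \<open>x * y\<close> has the factor
  \<open>p\<close>, so it lies below \<open>p\<close> by integrality.\<close>

lemma sup_times_sup_le: "sup p x * sup p y \<le> sup p ((x::'a::quantale) * y)"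
  unfolding times_sup_distrib sup_times_distrib
  by (auto intro: le_supI1 le_supI2 times_le_left times_le_right)

lemma inf_eq_times_if_comaximal:
  assumes "sup (x::'a::quantale) y = 1"
  shows "inf x y = x * y"
proof (rule antisym)
  \<comment> \<open>The meet is multiplied by \<open>1 = sup x y\<close>; in each of the two terms
    it is then bounded by the other variable.\<close>
  have "inf x y = sup (inf x y * x) (inf x y * y)"
    using times_sup_distrib[of "inf x y" x y] assms by simp
  also have "\<dots> \<le> sup (y * x) (x * y)"
    by (intro sup_mono times_mono) auto
  finally show "inf x y \<le> x * y" by (simp add: mult.commute)
qed (rule times_le_inf)

lemma sup_times_eq_one:
  assumes "sup (c::'a::quantale) x = 1" "sup c y = 1"
  shows "sup c (x * y) = 1"
  using sup_times_sup_le[of c x y] assms by (metis mult_1 one_eq_top top_unique)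

lemma sup_power_eq_one:
  assumes "sup (c::'a::quantale) s = 1"
  shows "sup (c ^ n) s = 1"
proof (induction n)
  case 0
  then show ?case by (simp add: one_eq_top)
next
  case (Suc n)
  \<comment> \<open>The two sides are swapped so that \<open>s\<close> is the fixed element,
    comaximal with both factors of \<open>c ^ Suc n\<close>.\<close>
  have "sup s c = 1" "sup s (c ^ n) = 1"
    using assms Suc by (simp_all add: sup.commute)
  then show ?case
    using sup_times_eq_one[of s c "c ^ n"] by (simp add: sup.commute)
qed

section \<open>Compact elements\<close>

lemma compact_leE:
  fixes c :: "'a::complete_lattice"
  assumes "c \<in> compact_elements" "c \<le> Sup S"
  obtains F where "finite F" "F \<subseteq> S" "c \<le> Sup F"
  using assms unfolding compact_elements_def by blast

lemma compact_Sup: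
  fixes F :: "'a::complete_lattice set"
  assumes "finite F" "F \<subseteq> compact_elements"
  shows "Sup F \<in> compact_elements"
  using assms by (induction F) (simp_all add: compact_bot compact_sup)

lemma compact_power: "(c::'a::coherent_quantale) \<in> compact_elements \<Longrightarrow> c ^ n \<in> compact_elements"
  by (induction n) (auto simp: one_compact times_compact)

lemma obtain_compact_not_le:
  fixes a b :: "'a::coherent_quantale"
  assumes "\<not> a \<le> b"
  obtains c where "c \<in> compact_elements" "c \<le> a" "\<not> c \<le> b"
proof -
  obtain S where "S \<subseteq> compact_elements" "a = Sup S"
    using Sup_compact by blast
  with assms that show thesis
    by (metis Sup_least Sup_upper subsetD)
qed

text \<open>Since \<open>b\<close> is a join of compact elements and \<open>1\<close> is compact,
  finitely many of them already reach \<open>1\<close> together with \<open>a\<close>; their join is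
  \<open>s\<close>.\<close>

lemma obtain_compact_comaximal:
  fixes a b :: "'a::coherent_quantale"
  assumes "sup a b = 1"
  obtains s where "s \<in> compact_elements" "s \<le> b" "sup a s = 1"
proof -
  obtain S where S: "S \<subseteq> compact_elements" "b = Sup S"
    using Sup_compact by blast
  then have "1 \<le> Sup (insert a S)" using assms by simp
  then obtain F where F: "finite F" "F \<subseteq> insert a S" "1 \<le> Sup F"
    by (rule compact_leE[OF one_compact])
  \<comment> \<open>\<open>a\<close> need not be compact, so it is taken out before the finite join
    is formed.\<close>
  let ?G = "F - {a}"
  have "Sup F \<le> Sup (insert a ?G)" by (rule Sup_subset_mono) auto
  with F(3) have "1 \<le> sup a (Sup ?G)" unfolding complete_lattice_class.Sup_insert by (rule order_trans)
  then have "sup a (Sup ?G) = 1" by (simp add: one_eq_top top_unique)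
  moreover have "?G \<subseteq> S" using F by auto
  ultimately show thesis
    using F(1) S by (intro that[of "Sup ?G"] compact_Sup Sup_subset_mono[of ?G S, folded S(2)]) auto
qed

section \<open>Prime elements\<close>

text \<open>A finite nonempty chain has a greatest element. With compactness this turns a bound by
  the join of a chain into a bound by one member.\<close>

lemma finite_chain_Sup_in:
  fixes F :: "'a::complete_lattice set"
  assumes "finite F" "F \<noteq> {}" "\<forall>x\<in>F. \<forall>y\<in>F. x \<le> y \<or> y \<le> x"
  shows "Sup F \<in> F"
  using assms
proof (induction F rule: finite_ne_induct)
  case (insert x F)
  then have "Sup F \<in> F" by simp
  with insert.prems have "x \<le> Sup F \<or> Sup F \<le> x" by simp
  with \<open>Sup F \<in> F\<close> show ?case by (auto simp: sup.absorb1 sup.absorb2)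
qed simp

text \<open>The quantale form of Krull's lemma: an element maximal among those above
  \<open>a\<close> and above no member of \<open>T\<close> is m-prime. Compactness of the members of
  \<open>T\<close> makes Zorn's lemma applicable.\<close>

lemma exists_prime_avoiding:
  fixes a :: "'a::quantale"
  assumes comp: "T \<subseteq> compact_elements" and "1 \<in> T"
    and mult: "\<And>s t. s \<in> T \<Longrightarrow> t \<in> T \<Longrightarrow> s * t \<in> T"
    and avoid: "\<And>t. t \<in> T \<Longrightarrow> \<not> t \<le> a"
  obtains p where "p \<in> Spec" "a \<le> p" "\<And>t. t \<in> T \<Longrightarrow> \<not> t \<le> p"
proof -
  define Q where "Q = {x. a \<le> x \<and> (\<forall>t\<in>T. \<not> t \<le> x)}"
  have "\<exists>m\<in>Q. \<forall>x\<in>Q. m \<le> x \<longrightarrow> x = m"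
  proof (rule predicate_Zorn)
    show "partial_order_on Q (relation_of (\<le>) Q)"
      by (rule partial_order_on_relation_ofI) auto
  next
    fix C assume C: "C \<in> Chains (relation_of (\<le>) Q)"
    then have CQ: "C \<subseteq> Q" and chain: "\<forall>x\<in>C. \<forall>y\<in>C. x \<le> y \<or> y \<le> x"
      by (auto simp: Chains_def relation_of_def)
    \<comment> \<open>Inserting \<open>a\<close> covers the empty chain and later keeps the finite
      set nonempty; \<open>a\<close> is comparable with all of \<open>C\<close>, being below
      it.\<close>
    show "\<exists>u\<in>Q. \<forall>x\<in>C. x \<le> u"
    proof (intro bexI ballI)
      fix x assume "x \<in> C"
      then show "x \<le> Sup (insert a C)" by (simp add: Sup_upper le_supI2)
    next
      have "\<not> t \<le> Sup (insert a C)" if "t \<in> T" for t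
      proof
        assume le: "t \<le> Sup (insert a C)"
        have "t \<in> compact_elements" using comp that by blast
        then obtain F where F: "finite F" "F \<subseteq> insert a C" "t \<le> Sup F"
          using le by (rule compact_leE)
        have "\<forall>x\<in>insert a C. \<forall>y\<in>insert a C. x \<le> y \<or> y \<le> x"
          using CQ chain by (auto simp: Q_def)
        then have "Sup (insert a F) \<in> insert a F"
          using F(1,2) by (intro finite_chain_Sup_in) (simp, simp, blast)
        moreover have "t \<le> Sup (insert a F)" using F(3) by (simp add: le_supI2)
        ultimately have "\<exists>x\<in>insert a C. t \<le> x" using F(2) by blast
        then show False using that avoid CQ by (auto simp: Q_def)
      qed
      then show "Sup (insert a C) \<in> Q" by (auto simp: Q_def)
    qed
  qed
  then obtain p where p: "a \<le> p" "\<And>t. t \<in> T \<Longrightarrow> \<not> t \<le> p"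
    and max: "\<And>x. x \<in> Q \<Longrightarrow> p \<le> x \<Longrightarrow> x = p"
    by (auto simp: Q_def)
  \<comment> \<open>By maximality a proper enlargement of \<open>p\<close> leaves \<open>Q\<close>,
    which can only happen by rising above a member of \<open>T\<close>.\<close>
  have meets: "\<exists>t\<in>T. t \<le> sup p x" if "\<not> x \<le> p" for x
  proof (rule ccontr)
    assume "\<not> ?thesis"
    then have "sup p x \<in> Q" using p(1) by (auto simp: Q_def intro: le_supI1)
    then have "sup p x = p" by (rule max) simp
    with that show False by (metis sup_ge2)
  qed
  have "x \<le> p \<or> y \<le> p" if "x * y \<le> p" for x y
  proof (rule ccontr)
    assume "\<not> (x \<le> p \<or> y \<le> p)"
    then obtain s t where st: "s \<in> T" "s \<le> sup p x" "t \<in> T" "t \<le> sup p y"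
      using meets by meson
    then have "s * t \<le> sup p (x * y)"
      using times_mono sup_times_sup_le order_trans by metis
    with that have "s * t \<le> p" by (simp add: sup.absorb1)
    with p(2) mult st show False by blast
  qed
  moreover have "p < 1"
    using p(2)[OF \<open>1 \<in> T\<close>] by (auto simp: one_eq_top top.not_eq_extremum[symmetric])
  ultimately have "p \<in> Spec" by (simp add: Spec_def)
  with p that show thesis by blast
qed

text \<open>This is the avoidance result for the multiplicative system \<open>{1}\<close>.\<close>

lemma exists_prime_above:
  fixes a :: "'a::coherent_quantale"
  assumes "a \<noteq> 1"
  obtains p where "p \<in> Spec" "a \<le> p"
proof (rule exists_prime_avoiding[of "{1}" a])
  show "\<And>t. t \<in> {1} \<Longrightarrow> \<not> t \<le> a"
    using assms by (auto simp: one_eq_top top_unique)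
qed (auto simp: one_compact)

lemma prime_power_le_iff:
  assumes "p \<in> Spec" "n > 0"
  shows "c ^ n \<le> p \<longleftrightarrow> (c::'a::quantale) \<le> p"
  using \<open>n > 0\<close>
proof (induction n rule: nat_induct_non_zero)
  case (Suc n)
  have "c * c ^ n \<le> p \<Longrightarrow> c \<le> p \<or> c ^ n \<le> p" using assms(1) by (simp add: Spec_def)
  moreover have "c \<le> p \<Longrightarrow> c * c ^ n \<le> p" using times_le_left order_trans by blast
  ultimately show ?case using Suc by auto
qed simp

text \<open>The zero product makes \<open>spec_V e\<close> and \<open>spec_V f\<close> cover the
  spectrum, and comaximality makes them disjoint.\<close>

lemma spec_V_comaximal:
  assumes "(e::'a::quantale) * f = bot" "sup e f = 1"
  shows "spec_V e = spec_D f"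
proof -
  have "spec_V e \<union> spec_V f = Spec" "spec_V e \<inter> spec_V f = {}"
    using assms by (metis spec_V_times spec_V_bot, metis spec_V_sup spec_V_one)
  then show ?thesis unfolding spec_D_eq by blast
qed

section \<open>Hyperarchimedean quantales\<close>

text \<open>Krull dimension at most zero, in order-theoretic form. It serves as the hub for all
  implications back to \<open>hyperarchimedean\<close>.\<close>

definition spec_antichain :: "'a::quantale itself \<Rightarrow> bool" where
  "spec_antichain (_ :: 'a itself) \<longleftrightarrow> (\<forall>p \<in> (Spec :: 'a set). \<forall>q \<in> Spec. p \<le> q \<longrightarrow> p = q)"

lemma spec_antichainI:
  fixes T :: "'a::coherent_quantale itself"
  assumes "\<And>p q c. \<lbrakk>(p::'a) \<in> Spec; q \<in> Spec; p \<le> q; p \<noteq> q; c \<in> compact_elements; c \<le> q; \<not> c \<le> p\<rbrakk> \<Longrightarrow> False"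
  shows "spec_antichain T"
  unfolding spec_antichain_def
  using assms by (metis antisym obtain_compact_not_le)

text \<open>A complement \<open>f\<close> of the power is shrunk to a compact \<open>s\<close> still
  comaximal with it; the product vanishes because it lies below the meet with
  \<open>f\<close>.\<close>

lemma hyperarchimedeanE:
  fixes c :: "'a::coherent_quantale"
  assumes "hyperarchimedean TYPE('a)" "c \<in> compact_elements"
  obtains n s where "n > 1" "s \<in> compact_elements" "c ^ n * s = bot" "sup (c ^ n) s = 1"
proof -
  obtain n f where n: "n > 1" "sup (c ^ n) f = 1" "inf (c ^ n) f = bot"
    using assms by (auto simp: hyperarchimedean_def complemented_elements_def one_eq_top)
  obtain s where s: "s \<in> compact_elements" "s \<le> f" "sup (c ^ n) s = 1"
    using n(2) by (rule obtain_compact_comaximal)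
  have "c ^ n * s \<le> inf (c ^ n) f"
    using s(2) times_le_inf[of "c ^ n" s] by (meson inf_mono order_refl order_trans)
  with n(3) have "c ^ n * s = bot" by (simp add: bot_unique)
  with n(1) s show thesis using that by blast
qed

text \<open>Positive powers of \<open>c\<close> lie below the same primes as \<open>c\<close>, and a
  suitable power has a compact complement \<open>s\<close>.\<close>

lemma hyperarchimedean_spec_V_eq_spec_D:
  fixes c :: "'a::coherent_quantale"
  assumes "hyperarchimedean TYPE('a)" "c \<in> compact_elements"
  obtains s where "s \<in> compact_elements" "spec_V c = spec_D s"
proof -
  obtain n s where *: "n > 1" "s \<in> compact_elements" "c ^ n * s = bot" "sup (c ^ n) s = 1"
    using assms by (rule hyperarchimedeanE)
  have "spec_V c = spec_V (c ^ n)"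
    using *(1) prime_power_le_iff[of _ n c] by (auto simp: spec_V_def)
  with *(3,4) spec_V_comaximal have "spec_V c = spec_D s" by metis
  with *(2) that show thesis by blast
qed

lemma hyperarchimedean_if_spec_antichain:
  assumes anti: "spec_antichain TYPE('a::coherent_quantale)"
  shows "hyperarchimedean TYPE('a)"
  unfolding hyperarchimedean_def
proof
  fix c :: 'a assume c: "c \<in> compact_elements"
  \<comment> \<open>The factor \<open>s\<close> forces a prime avoiding \<open>T\<close> to be
    non-comaximal with \<open>c\<close> (take \<open>n = 0\<close>), the power of \<open>c\<close>
    keeps \<open>c\<close> from lying below it (take \<open>s = 1\<close>), and
    \<open>bot \<in> T\<close> yields a complement.\<close>
  define T where "T = {c ^ n * s | n s. s \<in> compact_elements \<and> sup c s = 1}"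
  have TI: "c ^ n * s \<in> T" if "s \<in> compact_elements" "sup c s = 1" for n s
    using that by (auto simp: T_def)
  have sup_one: "sup c 1 = 1" by (simp add: one_eq_top)
  have "bot \<in> T"
  proof (rule ccontr)
    assume "bot \<notin> T"
    obtain p where p: "p \<in> Spec" "\<And>t. t \<in> T \<Longrightarrow> \<not> t \<le> p"
    proof (rule exists_prime_avoiding[of T bot])
      show "T \<subseteq> compact_elements"
        using c by (auto simp: T_def intro: times_compact compact_power)
      show "1 \<in> T" using TI[OF one_compact sup_one, of 0] by simp
      show "s * t \<in> T" if "s \<in> T" "t \<in> T" for s t
      proof -
        obtain m x n y where "s = c ^ m * x" "t = c ^ n * y" "x \<in> compact_elements"
          "y \<in> compact_elements" "sup c x = 1" "sup c y = 1"
          using \<open>s \<in> T\<close> \<open>t \<in> T\<close> unfolding T_def by blast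
        then show ?thesis
          using TI[of "x * y" "m + n"] by (simp add: times_compact sup_times_eq_one power_add ac_simps)
      qed
      show "\<not> t \<le> bot" if "t \<in> T" for t
        using that \<open>bot \<notin> T\<close> by (auto simp: bot_unique)
    qed (rule that)
    have "\<not> c \<le> p" using p(2) TI[OF one_compact sup_one, of 1] by simp
    \<comment> \<open>Comaximality would provide a compact \<open>s \<le> p\<close> with
      \<open>sup c s = 1\<close>, a member of \<open>T\<close> below \<open>p\<close>.\<close>
    have "sup c p \<noteq> 1"
    proof
      assume "sup c p = 1"
      then obtain s where "s \<in> compact_elements" "s \<le> p" "sup c s = 1"
        by (rule obtain_compact_comaximal)
      then show False using p(2) TI[of s 0] by simp
    qed
    then obtain q where "q \<in> Spec" "sup c p \<le> q" by (rule exists_prime_above)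
    then have "p = q" using anti p(1) by (simp add: spec_antichain_def)
    with \<open>sup c p \<le> q\<close> \<open>\<not> c \<le> p\<close> show False by simp
  qed
  then obtain n s where s: "bot = c ^ n * s" "sup c s = 1"
    unfolding T_def by blast
  \<comment> \<open>The exponent is raised by two because \<open>n\<close> may be \<open>0\<close>
    while the definition asks for an exponent above \<open>1\<close>; the product with
    \<open>s\<close> stays zero.\<close>
  have "c ^ (n + 2) * s = c\<^sup>2 * (c ^ n * s)"
    by (simp add: power_add power2_eq_square ac_simps)
  then have "inf (c ^ (n + 2)) s = bot"
    using inf_eq_times_if_comaximal[OF sup_power_eq_one[OF s(2)], of "n + 2"]
    by (simp flip: s(1) add: times_bot)
  then have "c ^ (n + 2) \<in> complemented_elements"
    using sup_power_eq_one[OF s(2)] unfolding complemented_elements_def one_eq_top by blast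
  then show "\<exists>n>1. c ^ n \<in> complemented_elements"
    by (intro exI[of _ "n + 2"]) auto
qed

text \<open>If a compact \<open>c\<close> lies below one prime but not the other, its power
  \<open>c ^ n\<close> behaves likewise, and the complement \<open>s\<close> avoids the first prime
  since otherwise \<open>1\<close> would lie below it.\<close>

lemma hyperarchimedean_separation:
  fixes p q :: "'a::coherent_quantale"
  assumes hyper: "hyperarchimedean TYPE('a)" and pq: "p \<in> Spec" "q \<in> Spec" "p \<noteq> q"
  shows "\<exists>c \<in> compact_elements. \<exists>d \<in> compact_elements. \<not> c \<le> p \<and> \<not> d \<le> q \<and> c * d = bot"
proof -
  have sep: "\<exists>c \<in> compact_elements. \<exists>d \<in> compact_elements. \<not> c \<le> x \<and> \<not> d \<le> y \<and> c * d = bot"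
    if "x \<in> Spec" "y \<in> Spec" "\<not> y \<le> x" for x y :: 'a
  proof -
    obtain c where c: "c \<in> compact_elements" "c \<le> y" "\<not> c \<le> x"
      using \<open>\<not> y \<le> x\<close> by (rule obtain_compact_not_le)
    obtain n s where *: "n > 1" "s \<in> compact_elements" "c ^ n * s = bot" "sup (c ^ n) s = 1"
      using hyper c(1) by (rule hyperarchimedeanE)
    then have "\<not> c ^ n \<le> x" "c ^ n \<le> y"
      using c that prime_power_le_iff[of _ n c] by auto
    moreover have "\<not> s \<le> y"
    proof
      assume "s \<le> y"
      with \<open>c ^ n \<le> y\<close> have "1 \<le> y" unfolding *(4)[symmetric] by (rule sup_least)
      with \<open>y \<in> Spec\<close> show False by (auto simp: Spec_def dest: leD)
    qed
    ultimately show ?thesis using *(2,3) c(1) compact_power by blast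
  qed
  show ?thesis
  \<comment> \<open>\<open>sep\<close> treats one direction of incomparability; in the other case
    antisymmetry permits exchanging the primes, and commutativity restores the product.\<close>
  proof (cases "q \<le> p")
    case True
    with pq(3) have "\<not> p \<le> q" by auto
    with sep[OF pq(2,1)] show ?thesis by (metis mult.commute)
  qed (use sep pq in blast)
qed

lemma spec_antichain_if_separation:
  assumes "\<forall>p \<in> (Spec :: 'a::coherent_quantale set). \<forall>q \<in> Spec. p \<noteq> q \<longrightarrow>
      (\<exists>c \<in> compact_elements. \<exists>d \<in> compact_elements. \<not> c \<le> p \<and> \<not> d \<le> q \<and> c * d = bot)"
  shows "spec_antichain TYPE('a)"
  unfolding spec_antichain_def
proof (intro ballI impI, rule ccontr)
  fix p q :: 'a assume pq: "p \<in> Spec" "q \<in> Spec" "p \<le> q" "p \<noteq> q"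
  with assms obtain c d where cd: "\<not> c \<le> p" "\<not> d \<le> q" "c * d = bot" by blast
  \<comment> \<open>Primality of \<open>p\<close> applied to the zero product forces
    \<open>d \<le> p \<le> q\<close>.\<close>
  have "c * d \<le> p" by (simp add: cd(3))
  with pq(1) cd(1) have "d \<le> p" by (auto simp: Spec_def)
  with cd(2) pq(3) show False by auto
qed

section \<open>Comparison of the topologies\<close>

lemma openin_zariski_downward:
  assumes "openin spec_zariski U" "q \<in> U" "p \<in> Spec" "(p::'a::quantale) \<le> q"
  shows "p \<in> U"
  using assms order_trans by (fastforce simp: openin_spec_zariski spec_V_def)

text \<open>Each basic set \<open>spec_V c\<close> is an up-set. Dually, Zariski-open sets are
  down-sets; hence neither topology can separate comparable primes.\<close>

lemma openin_flat_upward: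
  assumes "openin spec_flat U" "p \<in> U" "q \<in> Spec" "(p::'a::quantale) \<le> q"
  shows "q \<in> U"
proof -
  obtain c where "p \<in> spec_V c" "spec_V c \<subseteq> U"
    using assms(1,2) unfolding openin_spec_flat arbitrary_union_of_alt by metis
  with assms(3,4) show ?thesis by (auto simp: spec_V_def)
qed

lemma openin_zariski_spec_D: "openin spec_zariski (spec_D a)"
  by (auto simp: openin_spec_zariski spec_D_eq)

lemma openin_flat_spec_V: "c \<in> compact_elements \<Longrightarrow> openin spec_flat (spec_V c)"
  unfolding openin_spec_flat by (intro union_of_inc) (auto simp: arbitrary_def)

lemma openin_patch_spec_D_Int_spec_V:
  fixes c :: "'a::coherent_quantale"
  assumes "c \<in> compact_elements" "d \<in> compact_elements"
  shows "openin spec_patch (spec_D c \<inter> spec_V d)"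
  unfolding openin_spec_patch using assms by (intro union_of_inc) (auto simp: arbitrary_def)

lemma openin_patch_spec_V:
  fixes c :: "'a::coherent_quantale"
  assumes "c \<in> compact_elements"
  shows "openin spec_patch (spec_V c)"
proof -
  \<comment> \<open>\<open>1\<close> lies below no prime, so \<open>spec_D 1\<close> is the whole
    spectrum.\<close>
  have "spec_D 1 \<inter> spec_V c = spec_V c"
    using spec_V_subset by (auto simp: spec_D_eq spec_V_one)
  then show ?thesis using openin_patch_spec_D_Int_spec_V[OF one_compact assms] by simp
qed

section \<open>A basis and compactness of the Zariski topology\<close>

lemma zariski_basis:
  "openin (spec_zariski :: 'a::coherent_quantale topology)
     = arbitrary union_of (\<lambda>U. \<exists>c \<in> compact_elements. U = spec_D c)"
proof
  fix U :: "'a set"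
  show "openin spec_zariski U \<longleftrightarrow> (arbitrary union_of (\<lambda>U. \<exists>c \<in> compact_elements. U = spec_D c)) U"
  proof
    assume "openin spec_zariski U"
    then obtain a where U: "U = spec_D a" by (auto simp: openin_spec_zariski spec_D_eq)
    \<comment> \<open>As \<open>a\<close> is a join of compact elements, some compact
      \<open>c \<le> a\<close> is not below \<open>p\<close>, and \<open>c \<le> a\<close> gives the
      inclusion.\<close>
    have "\<exists>c \<in> compact_elements. p \<in> spec_D c \<and> spec_D c \<subseteq> U" if "p \<in> U" for p
    proof -
      have "\<not> a \<le> p" "p \<in> Spec" using that U by (auto simp: spec_D_def)
      then obtain c where "c \<in> compact_elements" "c \<le> a" "\<not> c \<le> p"
        by (meson obtain_compact_not_le)
      then show ?thesis using \<open>p \<in> Spec\<close> U order_trans by (auto simp: spec_D_def)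
    qed
    then show "(arbitrary union_of (\<lambda>U. \<exists>c \<in> compact_elements. U = spec_D c)) U"
      unfolding arbitrary_union_of_alt by blast
  next
    assume "(arbitrary union_of (\<lambda>U. \<exists>c \<in> compact_elements. U = spec_D c)) U"
    then show "openin spec_zariski U"
      unfolding union_of_def using openin_zariski_spec_D by (auto intro!: openin_Union)
  qed
qed

lemma compact_space_zariski: "compact_space (spec_zariski :: 'a::coherent_quantale topology)"
  unfolding compact_space_alt topspace_spec_zariski
proof (intro allI impI, elim conjE)
  fix \<U> :: "'a set set"
  assume "\<forall>U\<in>\<U>. openin spec_zariski U" and cover: "Spec \<subseteq> \<Union> \<U>"
  then obtain f where f: "\<And>U. U \<in> \<U> \<Longrightarrow> U = Spec - spec_V (f U)"
    unfolding openin_spec_zariski by metis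
  \<comment> \<open>A prime above this join would be left uncovered; compactness of \<open>1\<close>
    then extracts the finite subcover.\<close>
  have "Sup (f ` \<U>) = 1"
  proof (rule ccontr)
    assume "Sup (f ` \<U>) \<noteq> 1"
    then obtain p where "p \<in> Spec" "Sup (f ` \<U>) \<le> p" by (rule exists_prime_above)
    then have "p \<in> spec_V (f U)" if "U \<in> \<U>" for U
      using that by (auto simp: spec_V_def Sup_le_iff)
    with f cover \<open>p \<in> Spec\<close> show False by blast
  qed
  then obtain F where F: "finite F" "F \<subseteq> f ` \<U>" "1 \<le> Sup F"
    using compact_leE[OF one_compact, of "f ` \<U>"] by (metis order_refl)
  obtain \<F> where \<F>: "\<F> \<subseteq> \<U>" "finite \<F>" "F = f ` \<F>"
    using finite_subset_image[OF F(1,2)] by blast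
  have "Sup F = 1" using F(3) by (simp add: one_eq_top top_unique)
  then have "Spec \<inter> (\<Inter>a\<in>F. spec_V a) = {}" using spec_V_Sup[of F] spec_V_one by metis
  have "Spec \<subseteq> \<Union>\<F>"
  proof
    fix p :: 'a assume "p \<in> Spec"
    with \<open>Spec \<inter> _ = {}\<close> \<F>(3) obtain U where "U \<in> \<F>" "p \<notin> spec_V (f U)" by blast
    moreover from this \<F>(1) f[of U] \<open>p \<in> Spec\<close> have "p \<in> U" by blast
    ultimately show "p \<in> \<Union>\<F>" by blast
  qed
  with \<F> show "\<exists>\<F>. finite \<F> \<and> \<F> \<subseteq> \<U> \<and> Spec \<subseteq> \<Union>\<F>" by blast
qed

lemma topology_eq_basisI:
  assumes "openin X = arbitrary union_of P" "openin Y = arbitrary union_of Q"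
    and "\<And>U. P U \<Longrightarrow> openin Y U" "\<And>U. Q U \<Longrightarrow> openin X U"
  shows "X = Y"
proof -
  have "openin Y S" if "openin X S" for S
    using that assms(3) unfolding assms(1) union_of_def by (auto intro!: openin_Union)
  moreover have "openin X S" if "openin Y S" for S
    using that assms(4) unfolding assms(2) union_of_def by (auto intro!: openin_Union)
  ultimately show ?thesis by (auto simp: topology_eq)
qed

section \<open>The topologies over a hyperarchimedean quantale\<close>

lemma hyperarchimedean_openin_zariski_spec_V:
  fixes c :: "'a::coherent_quantale"
  assumes "hyperarchimedean TYPE('a)" "c \<in> compact_elements"
  shows "openin spec_zariski (spec_V c)"
  using hyperarchimedean_spec_V_eq_spec_D[OF assms] openin_zariski_spec_D by metis

lemma hyperarchimedean_zariski_eq_flat: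
  assumes "hyperarchimedean TYPE('a::coherent_quantale)"
  shows "(spec_zariski :: 'a topology) = spec_flat"
proof (rule topology_eq_basisI[OF zariski_basis openin_spec_flat])
  fix U :: "'a set"
  assume "\<exists>c\<in>compact_elements. U = spec_D c"
  then obtain c where c: "c \<in> compact_elements" "U = spec_D c" by blast
  obtain s where "s \<in> compact_elements" "spec_V c = spec_D s"
    using hyperarchimedean_spec_V_eq_spec_D[OF assms c(1)] by blast
  \<comment> \<open>Taking complements in \<open>spec_V c = spec_D s\<close> exchanges the two kinds
    of basic sets.\<close>
  moreover from this have "U = spec_V s"
    using c(2) spec_V_subset[of s] unfolding spec_D_eq by blast
  ultimately show "openin spec_flat U" by (simp add: openin_flat_spec_V)
qed (use assms hyperarchimedean_openin_zariski_spec_V in blast)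

lemma hyperarchimedean_zariski_eq_patch:
  assumes "hyperarchimedean TYPE('a::coherent_quantale)"
  shows "(spec_zariski :: 'a topology) = spec_patch"
proof (rule topology_eq_basisI[OF zariski_basis openin_spec_patch])
  fix U :: "'a set"
  assume "\<exists>c\<in>compact_elements. U = spec_D c"
  then obtain c where "c \<in> compact_elements" "U = spec_D c" by blast
  moreover have "spec_D c = spec_D c \<inter> spec_V bot"
    using spec_D_subset by (auto simp: spec_V_bot)
  ultimately show "openin spec_patch U"
    using openin_patch_spec_D_Int_spec_V compact_bot by metis
qed (use assms hyperarchimedean_openin_zariski_spec_V openin_zariski_spec_D in blast)

lemma hyperarchimedean_Hausdorff_zariski:
  assumes "hyperarchimedean TYPE('a::coherent_quantale)"
  shows "Hausdorff_space (spec_zariski :: 'a topology)"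
  unfolding Hausdorff_space_def topspace_spec_zariski
proof (intro allI impI, elim conjE)
  fix p q :: 'a assume pq: "p \<in> Spec" "q \<in> Spec" "p \<noteq> q"
  obtain c d where cd: "\<not> c \<le> p" "\<not> d \<le> q" "c * d = bot"
    using hyperarchimedean_separation[OF assms pq] by blast
  \<comment> \<open>The intersection is \<open>spec_D (c * d)\<close>, and \<open>bot\<close> lies
    below every prime.\<close>
  have "spec_D c \<inter> spec_D d = {}"
    using cd(3) spec_D_times[of c d] by (simp add: spec_D_eq spec_V_bot)
  then show "\<exists>U V. openin spec_zariski U \<and> openin spec_zariski V \<and> p \<in> U \<and> q \<in> V \<and> disjnt U V"
    using cd pq openin_zariski_spec_D[of c] openin_zariski_spec_D[of d]
    by (intro exI[of _ "spec_D c"] exI[of _ "spec_D d"]) (auto simp: disjnt_def spec_D_def)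
qed

lemma hyperarchimedean_Boolean_zariski:
  assumes "hyperarchimedean TYPE('a::coherent_quantale)"
  shows "Boolean_space (spec_zariski :: 'a topology)"
  unfolding Boolean_space_def
proof (intro conjI exI)
  show "compact_space (spec_zariski :: 'a topology)" by (rule compact_space_zariski)
  show "Hausdorff_space (spec_zariski :: 'a topology)"
    using assms by (rule hyperarchimedean_Hausdorff_zariski)
  let ?B = "spec_D ` compact_elements :: 'a set set"
  \<comment> \<open>Its complement \<open>spec_V c\<close> is Zariski-open by hyperarchimedeanity,
    so the basis of sets \<open>spec_D c\<close> is clopen.\<close>
  have "closedin spec_zariski (spec_D c)" if "c \<in> compact_elements" for c :: 'a
    using hyperarchimedean_openin_zariski_spec_V[OF assms that] spec_V_subset[of c]
    by (simp add: closedin_def topspace_spec_zariski spec_D_eq Diff_Diff_Int Int_absorb1)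
  then show "\<forall>B\<in>?B. openin spec_zariski B \<and> closedin spec_zariski B"
    by (auto simp: openin_zariski_spec_D)
  have "(\<lambda>U. \<exists>c \<in> compact_elements. U = spec_D c) = (\<lambda>U. U \<in> ?B)" by auto
  then show "openin spec_zariski = arbitrary union_of (\<lambda>U. U \<in> ?B)"
    using zariski_basis by metis
qed

section \<open>From topological conditions to the antichain condition\<close>

lemma spec_antichain_if_Hausdorff_zariski:
  assumes "Hausdorff_space (spec_zariski :: 'a::coherent_quantale topology)"
  shows "spec_antichain TYPE('a)"
  unfolding spec_antichain_def
proof (intro ballI impI, rule ccontr)
  fix p q :: 'a assume pq: "p \<in> Spec" "q \<in> Spec" "p \<le> q" "p \<noteq> q"
  then obtain U V where "openin spec_zariski V" "p \<in> U" "q \<in> V" "disjnt U V"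
    using assms unfolding Hausdorff_space_def topspace_spec_zariski by meson
  \<comment> \<open>The neighbourhood \<open>V\<close> of the larger prime \<open>q\<close> also
    contains \<open>p\<close>.\<close>
  then show False using openin_zariski_downward pq by (metis disjnt_iff)
qed

lemma spec_antichain_if_Hausdorff_flat:
  assumes "Hausdorff_space (spec_flat :: 'a::coherent_quantale topology)"
  shows "spec_antichain TYPE('a)"
  unfolding spec_antichain_def
proof (intro ballI impI, rule ccontr)
  fix p q :: 'a assume pq: "p \<in> Spec" "q \<in> Spec" "p \<le> q" "p \<noteq> q"
  then obtain U V where "openin spec_flat U" "p \<in> U" "q \<in> V" "disjnt U V"
    using assms unfolding Hausdorff_space_def topspace_spec_flat by meson
  then show False using openin_flat_upward pq by (metis disjnt_iff)
qed

text \<open>A Zariski-open \<open>spec_V c\<close> is a down-set, so \<open>c \<le> q\<close> passes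
  to every smaller prime. As \<open>spec_V c\<close> is open in both the patch and the flat
  topology, this covers both coincidence conditions.\<close>

lemma spec_antichain_if_openin_zariski_spec_V:
  assumes "\<And>c::'a::coherent_quantale. c \<in> compact_elements \<Longrightarrow> openin spec_zariski (spec_V c)"
  shows "spec_antichain TYPE('a)"
proof (rule spec_antichainI)
  fix p q c :: 'a
  assume *: "p \<in> Spec" "q \<in> Spec" "p \<le> q" "c \<in> compact_elements" "c \<le> q" "\<not> c \<le> p"
  then have "p \<in> spec_V c"
    using openin_zariski_downward[OF assms[OF *(4)], of q p] by (simp add: spec_V_def)
  with *(6) show False by (simp add: spec_V_def)
qed

section \<open>Equivalence of the conditions\<close>

theorem theorem6p8:
  shows
    "(hyperarchimedean TYPE('a::coherent_quantale) \<longleftrightarrow>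
        (\<forall>p \<in> (Spec :: 'a set). \<forall>q \<in> Spec. p \<noteq> q \<longrightarrow>
          (\<exists>c \<in> compact_elements. \<exists>d \<in> compact_elements.
             \<not> c \<le> p \<and> \<not> d \<le> q \<and> c * d = bot)))
   \<and> (hyperarchimedean TYPE('a) \<longleftrightarrow> Hausdorff_space (spec_zariski :: 'a topology))
   \<and> (hyperarchimedean TYPE('a) \<longleftrightarrow> Boolean_space (spec_zariski :: 'a topology))
   \<and> (hyperarchimedean TYPE('a) \<longleftrightarrow> (spec_zariski :: 'a topology) = spec_patch)
   \<and> (hyperarchimedean TYPE('a) \<longleftrightarrow> Hausdorff_space (spec_flat :: 'a topology))
   \<and> (hyperarchimedean TYPE('a) \<longleftrightarrow> Boolean_space (spec_flat :: 'a topology))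
   \<and> (hyperarchimedean TYPE('a) \<longleftrightarrow> (spec_zariski :: 'a topology) = spec_flat)"
proof -
  let ?H = "hyperarchimedean TYPE('a)"
  note anti = hyperarchimedean_if_spec_antichain
  have 2: "?H \<longleftrightarrow> (\<forall>p \<in> (Spec :: 'a set). \<forall>q \<in> Spec. p \<noteq> q \<longrightarrow>
      (\<exists>c \<in> compact_elements. \<exists>d \<in> compact_elements. \<not> c \<le> p \<and> \<not> d \<le> q \<and> c * d = bot))"
    using hyperarchimedean_separation anti[OF spec_antichain_if_separation] by blast
  have 3: "?H \<longleftrightarrow> Hausdorff_space (spec_zariski :: 'a topology)"
    using hyperarchimedean_Hausdorff_zariski anti[OF spec_antichain_if_Hausdorff_zariski] by blast
  have 4: "?H \<longleftrightarrow> Boolean_space (spec_zariski :: 'a topology)"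
    using hyperarchimedean_Boolean_zariski 3 by (auto simp: Boolean_space_def)
  have 5: "?H \<longleftrightarrow> (spec_zariski :: 'a topology) = spec_patch"
  proof
    assume "(spec_zariski :: 'a topology) = spec_patch"
    then show ?H by (intro anti spec_antichain_if_openin_zariski_spec_V) (simp add: openin_patch_spec_V)
  qed (rule hyperarchimedean_zariski_eq_patch)
  have 6: "?H \<longleftrightarrow> Hausdorff_space (spec_flat :: 'a topology)"
  proof
    assume ?H
    with 3 show "Hausdorff_space (spec_flat :: 'a topology)"
      \<comment> \<open>Under hyperarchimedeanity the two topologies agree, so the Zariski result
        transfers to the flat topology.\<close>
      unfolding hyperarchimedean_zariski_eq_flat[OF \<open>?H\<close>] by blast
  qed (intro anti spec_antichain_if_Hausdorff_flat)
  have 7: "?H \<longleftrightarrow> Boolean_space (spec_flat :: 'a topology)"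
  proof
    assume ?H
    with 4 show "Boolean_space (spec_flat :: 'a topology)"
      unfolding hyperarchimedean_zariski_eq_flat[OF \<open>?H\<close>] by blast
  next
    assume "Boolean_space (spec_flat :: 'a topology)"
    then show ?H using 6 by (simp add: Boolean_space_def)
  qed
  have 8: "?H \<longleftrightarrow> (spec_zariski :: 'a topology) = spec_flat"
  proof
    assume "(spec_zariski :: 'a topology) = spec_flat"
    then show ?H by (intro anti spec_antichain_if_openin_zariski_spec_V) (simp add: openin_flat_spec_V)
  qed (rule hyperarchimedean_zariski_eq_flat)
  show ?thesis using 2 3 4 5 6 7 8 by (intro conjI)
qed

end
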